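(* Let $f$ be an entire function, and suppose that the $n$th power $(f(z))^{n}$ is an even function of $z$ for some positive integer $n$. Then $f$ is even or $f$ is odd.
   Context: A function $h$ is even if $h(-z)=h(z)$ for all $z$, and odd if $h(-z)=-h(z)$ for all $z$. *)

theory Defs
  imports "HOL-Complex_Analysis.Complex_Analysis"
begin

definition even_fun :: "(complex \<Rightarrow> complex) \<Rightarrow> bool" where
  "even_fun h \<longleftrightarrow> (\<forall>z. h (- z) = h z)"

definition odd_fun :: "(complex \<Rightarrow> complex) \<Rightarrow> bool" where
  "odd_fun h \<longleftrightarrow> (\<forall>z. h (- z) = - h z)"

end

theory Submission
  imports Defs
begin

text \<open>The entire functions \<open>f z\<close> and \<open>f (- z)\<close> have equal
  \<open>n\<close>-th powers. Near a point where \<open>f\<close> does not vanish, their quotient is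
  continuous with values in the finitely many \<open>n\<close>-th roots of unity, hence a constant
  \<open>c\<close>; the identity theorem then gives \<open>f (- z) = c * f z\<close> everywhere.
  This is the lemma below, with \<open>f \<circ> uminus\<close> as \<open>g\<close>. Since negation
  is an involution, using the relation twice yields \<open>f = c\<^sup>2 f\<close>, so
  \<open>c\<close> is 1 or -1 unless \<open>f\<close> is identically zero.\<close>

lemma holomorphic_power_eq_imp_scalar_multiple:
  fixes f g :: "complex \<Rightarrow> complex"
  assumes f: "f holomorphic_on S" and g: "g holomorphic_on S"
    and S: "open S" "connected S"
    and n: "n > 0" and eq: "\<And>z. z \<in> S \<Longrightarrow> g z ^ n = f z ^ n"
  obtains c where "c ^ n = 1" "\<And>z. z \<in> S \<Longrightarrow> g z = c * f z"
proof (cases "\<forall>z\<in>S. f z = 0")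
  case True
  then have "\<And>z. z \<in> S \<Longrightarrow> g z = 1 * f z"
    using eq n by (simp add: power_0_left)
  then show thesis
    using that[of 1] by simp
next
  case False
  then obtain a where a: "a \<in> S" "f a \<noteq> 0"
    by blast
  have contf: "continuous_on S f"
    using f by (rule holomorphic_on_imp_continuous_on)
  then have "open {z \<in> S. f z \<noteq> 0}"
    using continuous_open_preimage[OF contf S(1), of "- {0}"]
    by (simp add: vimage_def Int_def open_Compl)
  then obtain r where r: "r > 0" "ball a r \<subseteq> {z \<in> S. f z \<noteq> 0}"
    using a by (metis (mono_tags, lifting) mem_Collect_eq open_contains_ball)
  \<comment> \<open>A ball is connected, which forces a finite-valued continuous quotient to be
    constant, and open, as the identity theorem requires.\<close>
  define B where "B = ball a r"
  have B: "open B" "connected B" "a \<in> B" "B \<subseteq> S" and nz: "\<And>z. z \<in> B \<Longrightarrow> f z \<noteq> 0"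
    using r by (auto simp: B_def)
  \<comment> \<open>The quotient \<open>q\<close> takes values in the finite set of \<open>n\<close>-th roots of unity, so it is constant on the ball.\<close>
  define q where "q = (\<lambda>z. g z / f z)"
  have "continuous_on B q"
    unfolding q_def using B(4) f g nz
    by (intro continuous_on_divide holomorphic_on_imp_continuous_on)
      (auto intro: holomorphic_on_subset)
  then have "connected (q ` B)"
    using B(2) by (rule connected_continuous_image)
  have roots: "q ` B \<subseteq> {w. w ^ n = 1}"
    using B(4) nz eq by (auto simp: q_def power_divide)
  have "finite {w::complex. w ^ n = 1}"
    using n by (intro finite_roots_unity) simp
  then have "finite (q ` B)"
    using roots finite_subset by blast
  with \<open>connected (q ` B)\<close> B(3) obtain c where c: "q ` B = {c}"
    using connected_finite_iff_sing by blast
  have on_ball: "g z = c * f z" if "z \<in> B" for z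
  proof -
    have "q z = c"
      using c that by blast
    then show ?thesis
      using nz[OF that] by (simp add: q_def divide_eq_eq)
  qed
  \<comment> \<open>The identity theorem on the connected set \<open>S\<close> carries the equation
    from \<open>B\<close> across the zeros of \<open>f\<close>, where \<open>q\<close> is not a
    meaningful quotient.\<close>
  have "g z = c * f z" if "z \<in> S" for z
  proof (rule analytic_continuation_open[of B S g "\<lambda>z. c * f z"])
    show "B \<noteq> {}"
      using B(3) by blast
    show "(\<lambda>z. c * f z) holomorphic_on S"
      using f by (intro holomorphic_intros)
  qed (use B S g on_ball that in simp_all)
  moreover have "c ^ n = 1"
    using roots c by auto
  ultimately show thesis
    using that by blast
qed

theorem lemma13:
  fixes f :: "complex \<Rightarrow> complex"
  assumes "f holomorphic_on UNIV"
    and "\<exists>n::nat. n > 0 \<and> even_fun (\<lambda>z. f z ^ n)"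
  shows "even_fun f \<or> odd_fun f"
proof -
  obtain n :: nat where n: "n > 0" "\<And>z. f (- z) ^ n = f z ^ n"
    using assms(2) by (auto simp: even_fun_def)
  have "(f \<circ> uminus) holomorphic_on UNIV"
    using assms(1) by (intro holomorphic_on_compose)
      (auto intro: holomorphic_intros holomorphic_on_subset)
  then obtain c where "\<And>z. z \<in> UNIV \<Longrightarrow> (f \<circ> uminus) z = c * f z"
    using holomorphic_power_eq_imp_scalar_multiple[OF assms(1) _ open_UNIV connected_UNIV n(1),
        of "f \<circ> uminus"] n(2)
    by (metis comp_apply)
  then have c: "\<And>z. f (- z) = c * f z"
    by simp
  show ?thesis
  proof (cases "\<forall>z. f z = 0")
    \<comment> \<open>Here the relation says nothing about \<open>c\<close>, but the zero function
      is even.\<close>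
    case True
    then show ?thesis
      by (simp add: even_fun_def)
  next
    case False
    then obtain a where "f a \<noteq> 0"
      by blast
    \<comment> \<open>The relation at \<open>- a\<close> followed by the relation at
      \<open>a\<close>; cancelling \<open>f a\<close> leaves \<open>c\<^sup>2 = 1\<close>.\<close>
    moreover have "f a = c * (c * f a)"
      using c[of a] c[of "- a"] by simp
    ultimately have "c\<^sup>2 = 1"
      by (simp add: power2_eq_square)
    then have "c = 1 \<or> c = -1"
      by (simp add: power2_eq_1_iff)
    then show ?thesis
      using c by (auto simp: even_fun_def odd_fun_def)
  qed
qed

end
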